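(* Let $m\in\mathbb{N}$ and let $q$ be a prime power with $(m,q)\neq(1,2)$. Then the restricted polynomial equivalence problem over $\mathrm{Mat}_m(\mathbb{F}_q)$ is polytime-reducible to $\textsc{PolEqv}(\mathrm{Hol}(q,m))$.
   Context: $\mathrm{Hol}(q,m)$ is the group of pairs $(a,B)$ with $a\in\mathbb{F}_q^m$, $B\in\mathrm{GL}_m(\mathbb{F}_q)$, and multiplication $(v,A)\cdot(w,B)=(v+Aw,AB)$. $\textsc{PolEqv}(G)$: given a word $w\in(G\cup X)^*$ ($X$ a set of variables), decide whether $w$ (read as a product in $G$) evaluates to $1$ under every assignment $X\to G$. A restricted polynomial expression over $\mathrm{Mat}_m(\mathbb{F}_q)$ is a finite, possibly empty, formal sum of nonempty words over noncommuting variables $x_1,\dots,x_n$ and elements of $\mathrm{GL}_m(\mathbb{F}_q)$, evaluated in the matrix ring. The restricted polynomial equivalence problem asks, given such $p$, whether $p(\mathbf{x})=0$ for all $\mathbf{x}\in\mathrm{GL}_m(\mathbb{F}_q)^n$. Polytime-reducible: there is a polynomial-time transformation $P$ of inputs with $A(e)\iff B(P(e))$. *)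

theory Defs
  imports
    "Jordan_Normal_Form.Matrix"
    "HOL-Computational_Algebra.Polynomial"
    "HOL-Number_Theory.Prime_Powers"
    "HOL-Library.Cardinality"
begin

subsection \<open>Deterministic multi-tape Turing machines\<close>

text \<open>
  Machines transform strings over an alphabet \<open>'a\<close> into strings over an alphabet \<open>'b\<close>.
  Tapes are infinite in both directions.  The input is written on the first tape and the output is
  read off the last tape (the two coincide for a one-tape machine).  The types of cells and states
  are infinite; finiteness of the alphabet and of the state set is imposed by \<open>wf_tm\<close>.
\<close>

datatype ('a, 'b) cell = Blank | Input 'a | Output 'b | Work nat

datatype move = MoveLeft | Stay | MoveRight

record ('a, 'b) tm =
  tapes :: nat
  states :: "nat set"
  alphabet :: "('a, 'b) cell set"
  start :: nat
  halt :: nat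
  delta :: "nat \<Rightarrow> ('a, 'b) cell list \<Rightarrow> nat \<times> (('a, 'b) cell \<times> move) list"

definition wf_tm :: "('a, 'b) tm \<Rightarrow> bool" where
  "wf_tm M \<longleftrightarrow>
     tapes M > 0 \<and> finite (states M) \<and> finite (alphabet M) \<and>
     Blank \<in> alphabet M \<and> start M \<in> states M \<and> halt M \<in> states M \<and>
     (\<forall>s\<in>states M. \<forall>cs. length cs = tapes M \<and> set cs \<subseteq> alphabet M \<longrightarrow>
        fst (delta M s cs) \<in> states M \<and>
        length (snd (delta M s cs)) = tapes M \<and>
        fst ` set (snd (delta M s cs)) \<subseteq> alphabet M)"

type_synonym ('a, 'b) tape = "(int \<Rightarrow> ('a, 'b) cell) \<times> int"

type_synonym ('a, 'b) config = "nat \<times> ('a, 'b) tape list"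

definition string_on_tape :: "('s \<Rightarrow> ('a, 'b) cell) \<Rightarrow> 's list \<Rightarrow> int \<Rightarrow> ('a, 'b) cell" where
  "string_on_tape c xs i = (if 0 \<le> i \<and> i < int (length xs) then c (xs ! nat i) else Blank)"

definition init_config :: "('a, 'b) tm \<Rightarrow> 'a list \<Rightarrow> ('a, 'b) config" where
  "init_config M xs =
     (start M, (string_on_tape Input xs, 0) # replicate (tapes M - 1) (\<lambda>_. Blank, 0))"

fun read_tape :: "('a, 'b) tape \<Rightarrow> ('a, 'b) cell" where
  "read_tape (f, h) = f h"

fun move_head :: "move \<Rightarrow> int \<Rightarrow> int" where
  "move_head MoveLeft h = h - 1"
| "move_head Stay h = h"
| "move_head MoveRight h = h + 1"

fun act_on_tape :: "('a, 'b) cell \<times> move \<Rightarrow> ('a, 'b) tape \<Rightarrow> ('a, 'b) tape" where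
  "act_on_tape (c, d) (f, h) = (f(h := c), move_head d h)"

fun step :: "('a, 'b) tm \<Rightarrow> ('a, 'b) config \<Rightarrow> ('a, 'b) config" where
  "step M (s, ts) =
     (if s = halt M then (s, ts)
      else (fst (delta M s (map read_tape ts)),
            map2 act_on_tape (snd (delta M s (map read_tape ts))) ts))"

definition outputs_within :: "('a, 'b) tm \<Rightarrow> 'a list \<Rightarrow> 'b list \<Rightarrow> nat \<Rightarrow> bool" where
  "outputs_within M xs ys T \<longleftrightarrow>
     (\<exists>t\<le>T. let (s, ts) = (step M ^^ t) (init_config M xs)
            in s = halt M \<and> fst (last ts) = string_on_tape Output ys)"


subsection \<open>Decision problems and polynomial-time reductions\<close>

text \<open>
  A decision problem consists of its instances, a string encoding of the instances, and the set of
  instances for which the answer is positive.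
\<close>

record ('i, 'a) problem =
  instances :: "'i set"
  encode :: "'i \<Rightarrow> 'a list"
  yes :: "'i set"

definition polytime_transformation ::
  "('i, 'a) problem \<Rightarrow> ('j, 'b) problem \<Rightarrow> ('i \<Rightarrow> 'j) \<Rightarrow> bool" where
  "polytime_transformation A B P \<longleftrightarrow>
     (\<forall>e\<in>instances A. P e \<in> instances B) \<and>
     (\<exists>(M :: ('a, 'b) tm) (T :: nat poly).
        wf_tm M \<and>
        (\<forall>e\<in>instances A. Input ` set (encode A e) \<subseteq> alphabet M) \<and>
        (\<forall>e\<in>instances A.
           outputs_within M (encode A e) (encode B (P e)) (poly T (length (encode A e)))))"

definition polytime_reducible :: "('i, 'a) problem \<Rightarrow> ('j, 'b) problem \<Rightarrow> bool" where
  "polytime_reducible A B \<longleftrightarrow>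
     (\<exists>P. polytime_transformation A B P \<and> (\<forall>e\<in>instances A. e \<in> yes A \<longleftrightarrow> P e \<in> yes B))"


subsection \<open>Words with constants and variables\<close>

datatype 'g letter = Const 'g | Var nat

definition consts_in :: "'g set \<Rightarrow> 'g letter list \<Rightarrow> bool" where
  "consts_in S w \<longleftrightarrow> (\<forall>g. Const g \<in> set w \<longrightarrow> g \<in> S)"

fun eval_letter :: "(nat \<Rightarrow> 'g) \<Rightarrow> 'g letter \<Rightarrow> 'g" where
  "eval_letter \<sigma> (Const g) = g"
| "eval_letter \<sigma> (Var i) = \<sigma> i"

definition eval_word :: "('g, 'x) monoid_scheme \<Rightarrow> (nat \<Rightarrow> 'g) \<Rightarrow> 'g letter list \<Rightarrow> 'g" where
  "eval_word G \<sigma> w = foldr (\<lambda>l r. eval_letter \<sigma> l \<otimes>\<^bsub>G\<^esub> r) w \<one>\<^bsub>G\<^esub>"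

definition eval_sum :: "('g, 'x) ring_scheme \<Rightarrow> (nat \<Rightarrow> 'g) \<Rightarrow> 'g letter list list \<Rightarrow> 'g" where
  "eval_sum R \<sigma> p = foldr (\<lambda>w r. eval_word R \<sigma> w \<oplus>\<^bsub>R\<^esub> r) p \<zero>\<^bsub>R\<^esub>"

text \<open>
  Constants come from a finite set fixed in advance, so each of them is a single symbol.  Variable
  indices are unbounded and are written in binary, least significant bit first.  Every summand of
  a formal sum is terminated by \<open>Plus\<close>.
\<close>

datatype 'g symbol = ConstSym 'g | VarSym | Bit bool | Plus

fun binary :: "nat \<Rightarrow> bool list" where
  "binary n = (if n = 0 then [] else odd n # binary (n div 2))"

declare binary.simps [simp del]

fun encode_letter :: "'g letter \<Rightarrow> 'g symbol list" where
  "encode_letter (Const g) = [ConstSym g]"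
| "encode_letter (Var i) = VarSym # map Bit (binary i)"

definition encode_word :: "'g letter list \<Rightarrow> 'g symbol list" where
  "encode_word w = concat (map encode_letter w)"

definition encode_sum :: "'g letter list list \<Rightarrow> 'g symbol list" where
  "encode_sum p = concat (map (\<lambda>w. encode_word w @ [Plus]) p)"


subsection \<open>The two equivalence problems\<close>

definition PolEqv :: "('g, 'x) monoid_scheme \<Rightarrow> ('g letter list, 'g symbol) problem" where
  "PolEqv G =
     \<lparr> instances = {w. consts_in (carrier G) w},
       encode = encode_word,
       yes = {w. consts_in (carrier G) w \<and>
                 (\<forall>\<sigma>. (\<forall>i. \<sigma> i \<in> carrier G) \<longrightarrow> eval_word G \<sigma> w = \<one>\<^bsub>G\<^esub>)} \<rparr>"

definition GL :: "nat \<Rightarrow> 'a::field mat set" where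
  "GL m = {A \<in> carrier_mat m m. invertible_mat A}"

definition Hol :: "nat \<Rightarrow> ('a::field vec \<times> 'a mat) monoid" where
  "Hol m =
     \<lparr> carrier = carrier_vec m \<times> GL m,
       mult = (\<lambda>(v, A) (w, B). (v + A *\<^sub>v w, A * B)),
       one = (0\<^sub>v m, 1\<^sub>m m) \<rparr>"

definition restricted_expressions :: "nat \<Rightarrow> 'a::field mat letter list list set" where
  "restricted_expressions m = {p. \<forall>w\<in>set p. w \<noteq> [] \<and> consts_in (GL m) w}"

text \<open>
  Only the finitely many variables occurring in \<open>p\<close> affect its value, so assigning invertible
  matrices to all variables amounts to letting the tuple of these variables range over
  invertible matrices.
\<close>

definition RestrictedPolEqv ::
  "nat \<Rightarrow> ('a::field mat letter list list, 'a mat symbol) problem" where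
  "RestrictedPolEqv m =
     \<lparr> instances = restricted_expressions m,
       encode = encode_sum,
       yes = {p \<in> restricted_expressions m.
                \<forall>\<sigma>. (\<forall>i. \<sigma> i \<in> GL m) \<longrightarrow>
                    eval_sum (ring_mat TYPE('a) m ()) \<sigma> p = \<zero>\<^bsub>ring_mat TYPE('a) m ()\<^esub>} \<rparr>"

end

theory Submission
  imports
    Defs
    "HOL-Algebra.Multiplicative_Group"
    "Jordan_Normal_Form.Gauss_Jordan_Elimination"
begin

text \<open>
  For a group element \<open>g = (a, A)\<close> and a translation \<open>t = (v, 1)\<close> one has
  \<open>g t g\<^sup>-\<^sup>1 = (A v, 1)\<close>, so products of conjugates of \<open>t\<close> add up matrices applied to \<open>v\<close>.
  A formal sum \<open>w\<^sub>1 + \<dots> + w\<^sub>k\<close> is mapped to the product of the words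
  \<open>(w\<^sub>i y) t (w\<^sub>i y)\<^sup>-\<^sup>1\<close>, where \<open>v\<close> is the first unit vector and \<open>y\<close> is a fresh
  variable; it evaluates to \<open>((w\<^sub>1 + \<dots> + w\<^sub>k) Y v, 1)\<close>, and \<open>Y v\<close> runs through all
  unit vectors.  Inverses are written as powers \<open>g\<^bsup>e-1\<^esup>\<close>, \<open>e\<close> being an exponent of the
  group, which spares the machine reversing words.  Renaming the variable \<open>i\<close> to \<open>2 i + 1\<close> puts a
  single bit in front of its binary representation and makes the variable \<open>0\<close> fresh.
\<close>

subsection \<open>Rewriting expressions\<close>

fun lift_letter :: "('g \<Rightarrow> 'h) \<Rightarrow> 'g letter \<Rightarrow> 'h letter" where
  "lift_letter j (Const g) = Const (j g)"
| "lift_letter j (Var i) = Var (2 * i + 1)"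

definition lift_word :: "('g \<Rightarrow> 'h) \<Rightarrow> 'g letter list \<Rightarrow> 'h letter list" where
  "lift_word j w = map (lift_letter j) w @ [Var 0]"

text \<open>If \<open>E\<close> is an exponent of the group, the trailing power is the inverse of
  \<open>u\<close>, so the word denotes the conjugate of \<open>t\<close> by
  \<open>u\<close>.\<close>

definition conj_word :: "nat \<Rightarrow> 'h \<Rightarrow> 'h letter list \<Rightarrow> 'h letter list" where
  "conj_word E t u = u @ [Const t] @ concat (replicate (E - 1) u)"

definition conj_product :: "('g \<Rightarrow> 'h) \<Rightarrow> nat \<Rightarrow> 'h \<Rightarrow> 'g letter list list \<Rightarrow> 'h letter list" where
  "conj_product j E t p = concat (map (\<lambda>w. conj_word E t (lift_word j w)) p)"

text \<open>The bit after \<open>VarSym\<close> is the new least significant bit of the index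
  \<open>2 * i + 1\<close>. \<open>Plus\<close> yields nothing, since the end of a summand is left
  to the control of the machine.\<close>

fun lift_symbol :: "('g \<Rightarrow> 'h) \<Rightarrow> 'g symbol \<Rightarrow> 'h symbol list" where
  "lift_symbol j (ConstSym g) = [ConstSym (j g)]"
| "lift_symbol j VarSym = [VarSym, Bit True]"
| "lift_symbol j (Bit b) = [Bit b]"
| "lift_symbol j Plus = []"

definition lift_symbols :: "('g \<Rightarrow> 'h) \<Rightarrow> 'g symbol list \<Rightarrow> 'h symbol list" where
  "lift_symbols j u = concat (map (lift_symbol j) u)"

text \<open>The encoding of \<open>conj_word\<close> for the lifted summand. A bare
  \<open>VarSym\<close> encodes \<open>Var 0\<close>, because the binary representation of 0 is
  empty.\<close>

definition conj_symbols :: "('g \<Rightarrow> 'h) \<Rightarrow> nat \<Rightarrow> 'h \<Rightarrow> 'g symbol list \<Rightarrow> 'h symbol list" where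
  "conj_symbols j E t u =
     lift_symbols j u @ [VarSym, ConstSym t] @
     concat (replicate (E - 1) (lift_symbols j u @ [VarSym]))"

section \<open>Encodings of the rewritten words\<close>

lemma lift_symbols_simps [simp]:
  "lift_symbols j [] = []"
  "lift_symbols j (x # u) = lift_symbol j x @ lift_symbols j u"
  "lift_symbols j (u @ v) = lift_symbols j u @ lift_symbols j v"
  by (simp_all add: lift_symbols_def)

lemma lift_symbols_Bit [simp]: "lift_symbols j (map Bit bs) = map Bit bs"
  by (induction bs) auto

lemma encode_word_simps [simp]:
  "encode_word [] = []"
  "encode_word (l # w) = encode_letter l @ encode_word w"
  "encode_word (w @ w') = encode_word w @ encode_word w'"
  by (simp_all add: encode_word_def)

lemma binary_odd: "binary (2 * i + 1) = True # binary i"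
  by (subst binary.simps) simp

lemma encode_lift_letter:
  "encode_letter (lift_letter j l) = lift_symbols j (encode_letter l)"
  by (cases l) (simp_all add: binary_odd[simplified])

lemma encode_lift_word: "encode_word (lift_word j w) = lift_symbols j (encode_word w) @ [VarSym]"
proof -
  have "encode_word (map (lift_letter j) w) = lift_symbols j (encode_word w)"
    by (induction w) (simp_all add: encode_lift_letter)
  moreover have "binary 0 = []"
    by (simp add: binary.simps)
  ultimately show ?thesis
    by (simp add: lift_word_def)
qed

lemma encode_concat_replicate:
  "encode_word (concat (replicate n u)) = concat (replicate n (encode_word u))"
  by (induction n) simp_all

text \<open>Words are encoded without separators, so concatenating words concatenates codes. The
  transformation thus becomes a rewriting of symbols, summand by summand, that the machine can
  perform.\<close>

lemma encode_conj_product: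
  "encode_word (conj_product j E t p) = concat (map (conj_symbols j E t) (map encode_word p))"
  by (induction p)
    (simp_all add: conj_product_def conj_word_def conj_symbols_def encode_concat_replicate
      encode_lift_word)

text \<open>Makes \<open>Plus\<close> an unambiguous marker for the end of a summand.\<close>

lemma Plus_notin_encode_word: "Plus \<notin> set (encode_word w)"
proof (induction w)
  case (Cons l w)
  then show ?case
    by (cases l) auto
qed simp

text \<open>Confines all inputs to a finite alphabet when \<open>S\<close> is finite.\<close>

lemma set_encode_word:
  assumes "consts_in S w"
  shows "set (encode_word w) \<subseteq> ConstSym ` S \<union> {VarSym, Bit True, Bit False}"
  using assms
proof (induction w)
  case (Cons l w)
  have "set (encode_letter l) \<subseteq> ConstSym ` S \<union> {VarSym, Bit True, Bit False}"
  proof (cases l)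
    case (Const g)
    then show ?thesis
      using Cons.prems by (simp add: consts_in_def)
  next
    case (Var i)
    have "Bit ` set (binary i) \<subseteq> {Bit True, Bit False}"
      by auto
    then show ?thesis
      using Var by auto
  qed
  moreover have "consts_in S w"
    using Cons.prems by (simp add: consts_in_def)
  ultimately show ?case
    using Cons.IH by simp
qed simp


subsection \<open>A machine that rewrites expressions\<close>

text \<open>
  State \<open>4 * c + k\<close> belongs to the \<open>c\<close>-th copy of the current summand.  For \<open>k = 0\<close> the machine
  copies symbols, for \<open>k = 1\<close> it inserts the additional bit of a variable index, for \<open>k = 2\<close> it
  inserts the constant \<open>t\<close>, and for \<open>k = 3\<close> it returns to the beginning of the summand.
\<close>

definition conj_delta ::
  "('g \<Rightarrow> 'h) \<Rightarrow> nat \<Rightarrow> 'h \<Rightarrow> nat \<Rightarrow> ('g symbol, 'h symbol) cell list \<Rightarrow>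
   nat \<times> (('g symbol, 'h symbol) cell \<times> move) list" where
  "conj_delta j E t s cs =
     (let c = s div 4; k = s mod 4; x = cs ! 0; y = cs ! 1 in
      if k = 0 then
        (case x of
           Input (ConstSym g) \<Rightarrow> (s, [(x, MoveRight), (Output (ConstSym (j g)), MoveRight)])
         | Input VarSym \<Rightarrow> (4 * c + 1, [(x, Stay), (Output VarSym, MoveRight)])
         | Input (Bit b) \<Rightarrow> (s, [(x, MoveRight), (Output (Bit b), MoveRight)])
         | Input Plus \<Rightarrow>
             (if c = 0 then (2, [(x, Stay), (Output VarSym, MoveRight)])
              else if Suc c < E then
                (4 * Suc c + 3, [(x, MoveLeft), (Output VarSym, MoveRight)])
              else (0, [(x, MoveRight), (Output VarSym, MoveRight)]))
         | _ \<Rightarrow> (4 * E, [(x, Stay), (y, Stay)]))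
      else if k = 1 then (4 * c, [(x, MoveRight), (Output (Bit True), MoveRight)])
      else if k = 2 then (7, [(x, MoveLeft), (Output (ConstSym t), MoveRight)])
      else if x = Input Plus \<or> x = Blank then (4 * c, [(x, MoveRight), (y, Stay)])
      else (s, [(x, MoveLeft), (y, Stay)]))"

text \<open>Copies 0 to \<open>E - 1\<close> use the states below \<open>4 * E\<close>. The whole
  block that starts with the halting state belongs to the state set, so that the transition function
  stays inside it even when applied to the halting state.\<close>

definition conj_tm ::
  "'g set \<Rightarrow> ('g \<Rightarrow> 'h) \<Rightarrow> nat \<Rightarrow> 'h \<Rightarrow> ('g symbol, 'h symbol) tm" where
  "conj_tm S j E t =
     \<lparr> tapes = 2, states = {..<4 * E + 4},
       alphabet = {Blank} \<union> Input ` (ConstSym ` S \<union> {VarSym, Bit True, Bit False, Plus})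
         \<union> Output ` (ConstSym ` (insert t (j ` S)) \<union> {VarSym, Bit True, Bit False}),
       start = 0, halt = 4 * E, delta = conj_delta j E t \<rparr>"

lemma wf_conj_tm:
  assumes "finite S" and "E > 0"
  shows "wf_tm (conj_tm S j E t)"
proof -
  let ?M = "conj_tm S j E t"
  have "fst (delta ?M s cs) \<in> states ?M \<and> length (snd (delta ?M s cs)) = tapes ?M \<and>
      fst ` set (snd (delta ?M s cs)) \<subseteq> alphabet ?M"
    if s: "s \<in> states ?M" and len: "length cs = tapes ?M" and cs: "set cs \<subseteq> alphabet ?M" for s cs
  proof -
    obtain x y where xy: "cs = [x, y]"
      using len by (auto simp: conj_tm_def length_Suc_conv numeral_2_eq_2)
    have x: "x \<in> alphabet ?M" and y: "y \<in> alphabet ?M"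
      using cs xy by auto
    have out: "Output VarSym \<in> alphabet ?M" "Output (Bit b) \<in> alphabet ?M"
      "Output (ConstSym t) \<in> alphabet ?M"
      "Input (ConstSym g) \<in> alphabet ?M \<Longrightarrow> Output (ConstSym (j g)) \<in> alphabet ?M" for b g
      by (cases b) (auto simp: conj_tm_def)
    define c k where "c = s div 4" and "k = s mod 4"
    have s: "s < 4 * E + 4" and c: "c < Suc E"
      using s by (auto simp: conj_tm_def c_def)
    have M: "states ?M = {..<4 * E + 4}" "tapes ?M = 2" "delta ?M = conj_delta j E t"
      by (simp_all add: conj_tm_def)
    show ?thesis
      using x y c s assms(2)
      unfolding xy M conj_delta_def Let_def c_def[symmetric] k_def[symmetric]
      by (cases x) (auto simp: out split: symbol.split)
  qed
  with assms(1) show ?thesis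
    by (auto simp: wf_tm_def) (auto simp: conj_tm_def)
qed

section \<open>Runs of the machine and bounds on their length\<close>

definition runs :: "('a, 'b) tm \<Rightarrow> nat \<Rightarrow> ('a, 'b) config \<Rightarrow> ('a, 'b) config \<Rightarrow> bool" where
  "runs M n C C' \<longleftrightarrow> (\<exists>t\<le>n. (step M ^^ t) C = C')"

lemma runs_refl: "runs M n C C"
  unfolding runs_def by (rule exI[of _ 0]) simp

lemma runs_step: "step M C = C' \<Longrightarrow> runs M 1 C C'"
  unfolding runs_def by (rule exI[of _ 1]) simp

text \<open>Only upper bounds on the number of steps are tracked, so the estimates of successive
  phases may be added and rounded up.\<close>

lemma runs_trans:
  assumes "runs M a C C'" and "runs M b C' C''" and "a + b \<le> n"
  shows "runs M n C C''"
proof -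
  obtain s t where "s \<le> a" "(step M ^^ s) C = C'" "t \<le> b" "(step M ^^ t) C' = C''"
    using assms unfolding runs_def by blast
  then have "t + s \<le> n \<and> (step M ^^ (t + s)) C = C''"
    using assms(3) by (simp add: funpow_add)
  then show ?thesis
    unfolding runs_def by blast
qed

lemma string_on_tape_nth [simp]:
  "string_on_tape c (pre @ x # post) (int (length pre)) = c x"
  by (simp add: string_on_tape_def)

lemma string_on_tape_end [simp]: "string_on_tape c xs (int (length xs)) = Blank"
  by (simp add: string_on_tape_def)

lemma string_on_tape_snoc:
  "string_on_tape c (xs @ [x]) = (string_on_tape c xs)(int (length xs) := c x)"
  by (rule ext) (auto simp: string_on_tape_def nth_append)

definition io_config ::
  "'a list \<Rightarrow> nat \<Rightarrow> int \<Rightarrow> 'b list \<Rightarrow> ('a, 'b) config" where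
  "io_config xs s i ys =
     (s, [(string_on_tape Input xs, i), (string_on_tape Output ys, int (length ys))])"

text \<open>The output head rests on the blank cell behind the output, so the second symbol read is
  \<open>Blank\<close> and writing there appends \<open>z\<close>. The symbol \<open>x\<close> is
  written back, which keeps the input intact.\<close>

lemma step_write:
  assumes "string_on_tape Input xs i = x" and "s \<noteq> halt M"
    and "delta M s [x, Blank] = (s', [(x, d), (Output z, MoveRight)])"
  shows "step M (io_config xs s i ys) = io_config xs s' (move_head d i) (ys @ [z])"
  using assms by (simp add: io_config_def string_on_tape_snoc fun_upd_idem)

lemma step_silent:
  assumes "string_on_tape Input xs i = x" and "s \<noteq> halt M"
    and "delta M s [x, Blank] = (s', [(x, d), (Blank, Stay)])"
  shows "step M (io_config xs s i ys) = io_config xs s' (move_head d i) ys"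
  using assms by (simp add: io_config_def fun_upd_idem)

section \<open>Processing a summand and a whole sum\<close>

context
  fixes S :: "'g set" and j :: "'g \<Rightarrow> 'h" and E :: nat and t :: 'h
  assumes E: "2 \<le> E"
begin

private abbreviation (input) "M \<equiv> conj_tm S j E t"

lemma copy_symbol:
  assumes "c < E" and "x \<noteq> Plus"
  shows "runs M 2 (io_config (pre @ x # post) (4 * c) (int (length pre)) ys)
    (io_config (pre @ x # post) (4 * c) (int (length pre) + 1) (ys @ lift_symbol j x))"
proof (cases "x = VarSym")
  case True
  let ?i = "int (length pre)"
  have "step M (io_config (pre @ x # post) (4 * c) ?i ys) =
      io_config (pre @ x # post) (4 * c + 1) (move_head Stay ?i) (ys @ [VarSym])"
    by (rule step_write[OF string_on_tape_nth]) (use assms True in \<open>simp_all add: conj_tm_def conj_delta_def Let_def\<close>)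
  moreover have "step M (io_config (pre @ x # post) (4 * c + 1) ?i (ys @ [VarSym])) =
      io_config (pre @ x # post) (4 * c) (move_head MoveRight ?i) ((ys @ [VarSym]) @ [Bit True])"
    by (rule step_write[OF string_on_tape_nth])
      (use assms True in \<open>simp_all add: conj_tm_def conj_delta_def Let_def\<close>)
  ultimately show ?thesis
    using True by (auto intro: runs_trans[OF runs_step runs_step])
next
  case False
  then obtain z where z: "lift_symbol j x = [z]"
    using assms(2) by (cases x) auto
  have "step M (io_config (pre @ x # post) (4 * c) (int (length pre)) ys) =
      io_config (pre @ x # post) (4 * c) (move_head MoveRight (int (length pre))) (ys @ [z])"
    by (rule step_write[OF string_on_tape_nth])
      (use assms False z in \<open>auto simp: conj_tm_def conj_delta_def Let_def split: symbol.splits\<close>)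
  then show ?thesis
    \<comment> \<open>A single step suffices here; the bound is padded to the two steps that
      \<open>VarSym\<close> takes.\<close>
    using z by (auto intro: runs_trans[OF runs_step runs_refl[where n = 1]])
qed

lemma copy_summand:
  assumes "c < E" and "Plus \<notin> set u"
  shows "runs M (2 * length u) (io_config (pre @ u @ post) (4 * c) (int (length pre)) ys)
    (io_config (pre @ u @ post) (4 * c) (int (length (pre @ u))) (ys @ lift_symbols j u))"
  using assms(2)
proof (induction u arbitrary: pre ys)
  case Nil
  then show ?case
    by (simp add: runs_refl)
next
  case (Cons x u)
  have "runs M 2 (io_config (pre @ (x # u) @ post) (4 * c) (int (length pre)) ys)
      (io_config ((pre @ [x]) @ u @ post) (4 * c) (int (length (pre @ [x]))) (ys @ lift_symbol j x))"
    using copy_symbol[OF assms(1), of x pre "u @ post" ys] Cons.prems by (auto simp: add.commute)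
  moreover have "runs M (2 * length u)
      (io_config ((pre @ [x]) @ u @ post) (4 * c) (int (length (pre @ [x]))) (ys @ lift_symbol j x))
      (io_config (pre @ (x # u) @ post) (4 * c) (int (length (pre @ x # u)))
        (ys @ lift_symbols j (x # u)))"
    using Cons.IH[of "pre @ [x]" "ys @ lift_symbol j x"] Cons.prems by simp
  ultimately show ?case
    by (rule runs_trans) simp
qed

text \<open>The head starts on the last symbol of \<open>u\<close> and moves left until it meets the
  \<open>Plus\<close> of the preceding summand or the blank in front of the input. The extra step
  turns it back to the first cell of the summand.\<close>

lemma rewind_summand:
  assumes "c < E" and "Plus \<notin> set u" and "pre = [] \<or> last pre = Plus"
  shows "runs M (length u + 1)
    (io_config (pre @ u @ post) (4 * c + 3) (int (length (pre @ u)) - 1) ys)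
    (io_config (pre @ u @ post) (4 * c) (int (length pre)) ys)"
  using assms(2)
proof (induction u arbitrary: post rule: rev_induct)
  case Nil
  \<comment> \<open>For empty \<open>u\<close> the head is already on the cell to the left of the
    summand. If \<open>pre\<close> is empty this is position -1, which is blank since tapes extend
    in both directions.\<close>
  obtain x :: "('g symbol, 'h symbol) cell"
    where h: "string_on_tape Input (pre @ post) (int (length pre) - 1) = x"
    and x: "x = Blank \<or> x = Input Plus"
  proof (cases pre rule: rev_cases)
    case Nil
    with that show thesis
      by (simp add: string_on_tape_def)
  next
    case (snoc pre' x)
    then have "string_on_tape Input (pre @ post) (int (length pre) - 1) = Input Plus"
      using assms(3) string_on_tape_nth[of Input pre' Plus post] by simp
    with that show thesis
      by blast
  qed
  from h have "step M (io_config (pre @ post) (4 * c + 3) (int (length pre) - 1) ys) =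
      io_config (pre @ post) (4 * c) (move_head MoveRight (int (length pre) - 1)) ys"
    by (rule step_silent) (use assms(1) x in \<open>auto simp: conj_tm_def conj_delta_def Let_def\<close>)
  then show ?case
    by (simp add: runs_step[simplified])
next
  case (snoc x u)
  have "string_on_tape Input (pre @ u @ x # post) (int (length (pre @ u))) = Input x"
    using string_on_tape_nth[of Input "pre @ u" x post] by simp
  then have "step M (io_config (pre @ u @ x # post) (4 * c + 3) (int (length (pre @ u))) ys) =
      io_config (pre @ u @ x # post) (4 * c + 3) (move_head MoveLeft (int (length (pre @ u)))) ys"
    by (rule step_silent)
      (use assms(1) snoc.prems in \<open>auto simp: conj_tm_def conj_delta_def Let_def\<close>)
  from runs_step[OF this] have "runs M 1
      (io_config (pre @ (u @ [x]) @ post) (4 * c + 3) (int (length (pre @ u @ [x])) - 1) ys)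
      (io_config (pre @ u @ (x # post)) (4 * c + 3) (int (length (pre @ u)) - 1) ys)"
    by simp
  moreover have "runs M (length u + 1)
      (io_config (pre @ u @ (x # post)) (4 * c + 3) (int (length (pre @ u)) - 1) ys)
      (io_config (pre @ (u @ [x]) @ post) (4 * c) (int (length pre)) ys)"
    using snoc.IH[of "x # post"] snoc.prems by simp
  ultimately show ?case
    by (rule runs_trans) simp
qed

text \<open>The \<open>VarSym\<close> written at the end of every copy is the fresh variable. Copy 0
  continues with the constant, a middle copy with rewinding, and the last copy moves on past
  \<open>Plus\<close>.\<close>

lemma step_Plus:
  assumes "c < E"
    and "c = 0 \<Longrightarrow> s' = 2 \<and> d = Stay"
    and "0 < c \<Longrightarrow> Suc c < E \<Longrightarrow> s' = 4 * Suc c + 3 \<and> d = MoveLeft"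
    and "0 < c \<Longrightarrow> Suc c = E \<Longrightarrow> s' = 0 \<and> d = MoveRight"
  shows "step M (io_config (pre @ u @ Plus # post) (4 * c) (int (length (pre @ u))) ys) =
    io_config (pre @ u @ Plus # post) s' (move_head d (int (length (pre @ u)))) (ys @ [VarSym])"
proof (rule step_write)
  show "string_on_tape Input (pre @ u @ Plus # post) (int (length (pre @ u))) = Input Plus"
    using string_on_tape_nth[of Input "pre @ u" Plus post] by simp
  show "4 * c \<noteq> halt M"
    using assms(1) by (simp add: conj_tm_def)
  show "delta M (4 * c) [Input Plus, Blank] = (s', [(Input Plus, d), (Output VarSym, MoveRight)])"
    using assms by (cases "Suc c = E") (auto simp: conj_tm_def conj_delta_def Let_def)
qed

text \<open>Induction on the number \<open>n\<close> of copies after the current one. A copy takes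
  \<open>2 * length u\<close> steps, one step at \<open>Plus\<close> and, unless it is the last,
  \<open>length u + 1\<close> steps of rewinding, hence at most three steps per symbol of the
  summand including its \<open>Plus\<close>.\<close>

lemma later_copies:
  assumes "Plus \<notin> set u" and "pre = [] \<or> last pre = Plus" and "c + Suc n = E" and "0 < c"
  shows "runs M (Suc n * (3 * length u + 3))
    (io_config (pre @ u @ Plus # post) (4 * c) (int (length pre)) ys)
    (io_config (pre @ u @ Plus # post) 0 (int (length (pre @ u @ [Plus])))
      (ys @ concat (replicate (Suc n) (lift_symbols j u @ [VarSym]))))"
  using assms(3,4)
proof (induction n arbitrary: c ys)
  case 0
  have "runs M 1
      (io_config (pre @ u @ Plus # post) (4 * c) (int (length (pre @ u))) (ys @ lift_symbols j u))
      (io_config (pre @ u @ Plus # post) 0 (int (length (pre @ u @ [Plus])))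
        (ys @ lift_symbols j u @ [VarSym]))"
    using runs_step[OF step_Plus[of c 0 MoveRight pre u post "ys @ lift_symbols j u"]] 0
    by (simp add: add_ac)
  with copy_summand[OF _ assms(1)] have "runs M (3 * length u + 3)
      (io_config (pre @ u @ Plus # post) (4 * c) (int (length pre)) ys)
      (io_config (pre @ u @ Plus # post) 0 (int (length (pre @ u @ [Plus])))
        (ys @ lift_symbols j u @ [VarSym]))"
    by (rule runs_trans) (use 0 in auto)
  then show ?case
    by simp
next
  case (Suc n)
  let ?ys = "ys @ lift_symbols j u @ [VarSym]"
  have "runs M 1
      (io_config (pre @ u @ Plus # post) (4 * c) (int (length (pre @ u))) (ys @ lift_symbols j u))
      (io_config (pre @ u @ Plus # post) (4 * Suc c + 3) (int (length (pre @ u)) - 1) ?ys)"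
    using runs_step[OF step_Plus[of c "4 * Suc c + 3" MoveLeft pre u post "ys @ lift_symbols j u"]]
      Suc.prems by simp
  with copy_summand[OF _ assms(1)] have "runs M (2 * length u + 1)
      (io_config (pre @ u @ Plus # post) (4 * c) (int (length pre)) ys)
      (io_config (pre @ u @ Plus # post) (4 * Suc c + 3) (int (length (pre @ u)) - 1) ?ys)"
    by (rule runs_trans) (use Suc.prems in auto)
  then have "runs M (3 * length u + 3)
      (io_config (pre @ u @ Plus # post) (4 * c) (int (length pre)) ys)
      (io_config (pre @ u @ Plus # post) (4 * Suc c) (int (length pre)) ?ys)"
    by (rule runs_trans[OF _ rewind_summand[OF _ assms(1,2)]]) (use Suc.prems in auto)
  from runs_trans[OF this Suc.IH[of "Suc c" ?ys] order.refl] show ?case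
    using Suc.prems by (simp add: algebra_simps)
qed

lemma process_summand:
  assumes "Plus \<notin> set u" and "pre = [] \<or> last pre = Plus"
  shows "runs M (3 * E * length (u @ [Plus]))
    (io_config (pre @ u @ Plus # post) 0 (int (length pre)) ys)
    (io_config (pre @ u @ Plus # post) 0 (int (length (pre @ u @ [Plus])))
      (ys @ conj_symbols j E t u))"
proof -
  \<comment> \<open>Copy 0 is treated apart because the constant follows it;
    \<open>later_copies\<close> covers the \<open>Suc n = E - 1\<close> copies from copy 1 on. That
    copy 1 exists is ensured by \<open>E\<close> being at least 2.\<close>
  define n where "n = E - 2"
  have n: "E = Suc (Suc n)"
    using E by (simp add: n_def)
  let ?xs = "pre @ u @ Plus # post" and ?i = "int (length (pre @ u))"
  let ?ys = "ys @ lift_symbols j u @ [VarSym]" and ?zs = "ys @ lift_symbols j u @ [VarSym, ConstSym t]"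
  have "string_on_tape Input ?xs ?i = Input Plus"
    using string_on_tape_nth[of Input "pre @ u" Plus post] by simp
  \<comment> \<open>The state 7 reached here is \<open>4 * 1 + 3\<close>, the rewinding state of
    copy 1.\<close>
  then have "step M (io_config ?xs 2 ?i ?ys) =
      io_config ?xs (4 * 1 + 3) (move_head MoveLeft ?i) (?ys @ [ConstSym t])"
    by (rule step_write) (use E in \<open>auto simp: conj_tm_def conj_delta_def Let_def\<close>)
  from runs_step[OF this]
  have insert_const: "runs M 1 (io_config ?xs 2 ?i ?ys) (io_config ?xs (4 * 1 + 3) (?i - 1) ?zs)"
    by simp
  have "runs M 1 (io_config ?xs (4 * 0) ?i (ys @ lift_symbols j u)) (io_config ?xs 2 ?i ?ys)"
    using runs_step[OF step_Plus[of 0 2 Stay pre u post "ys @ lift_symbols j u"]] E by simp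
  with copy_summand[OF _ assms(1)]
  have "runs M (2 * length u + 1)
      (io_config ?xs (4 * 0) (int (length pre)) ys) (io_config ?xs 2 ?i ?ys)"
    by (rule runs_trans) (use E in auto)
  from this insert_const
  have "runs M (2 * length u + 2)
      (io_config ?xs (4 * 0) (int (length pre)) ys) (io_config ?xs (4 * 1 + 3) (?i - 1) ?zs)"
    by (rule runs_trans) simp
  then have "runs M (3 * length u + 3)
      (io_config ?xs (4 * 0) (int (length pre)) ys) (io_config ?xs (4 * 1) (int (length pre)) ?zs)"
    by (rule runs_trans[OF _ rewind_summand[OF _ assms]]) (use E in auto)
  from runs_trans[OF this later_copies[OF assms, of 1 n] order.refl] show ?thesis
    by (simp add: n conj_symbols_def algebra_simps)
qed

text \<open>The part already read stays empty or ends with \<open>Plus\<close>, where rewinding in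
  the next summand stops.\<close>

lemma process_sum:
  assumes "\<And>u. u \<in> set us \<Longrightarrow> Plus \<notin> set u" and "pre = [] \<or> last pre = Plus"
    and "xs = pre @ concat (map (\<lambda>u. u @ [Plus]) us)"
  shows "runs M (3 * E * length (concat (map (\<lambda>u. u @ [Plus]) us)))
    (io_config xs 0 (int (length pre)) ys)
    (io_config xs 0 (int (length xs)) (ys @ concat (map (conj_symbols j E t) us)))"
  using assms
proof (induction us arbitrary: pre ys)
  case Nil
  then show ?case
    by (simp add: runs_refl)
next
  case (Cons u us)
  let ?post = "concat (map (\<lambda>u. u @ [Plus]) us)"
  have xs: "xs = pre @ u @ Plus # ?post"
    using Cons.prems by simp
  have "runs M (3 * E * length (u @ [Plus])) (io_config xs 0 (int (length pre)) ys)
      (io_config xs 0 (int (length (pre @ u @ [Plus]))) (ys @ conj_symbols j E t u))"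
    unfolding xs by (rule process_summand) (use Cons.prems in auto)
  moreover have "runs M (3 * E * length ?post)
      (io_config xs 0 (int (length (pre @ u @ [Plus]))) (ys @ conj_symbols j E t u))
      (io_config xs 0 (int (length xs))
        ((ys @ conj_symbols j E t u) @ concat (map (conj_symbols j E t) us)))"
    by (rule Cons.IH) (use Cons.prems in auto)
  ultimately have "runs M (3 * E * length (u @ [Plus]) + 3 * E * length ?post)
      (io_config xs 0 (int (length pre)) ys)
      (io_config xs 0 (int (length xs))
        ((ys @ conj_symbols j E t u) @ concat (map (conj_symbols j E t) us)))"
    by (rule runs_trans) simp
  then show ?case
    by (simp add: algebra_simps)
qed

text \<open>Each input symbol accounts for at most \<open>3 * E\<close> steps, and one more step
  halts at the blank behind the input. As \<open>E\<close> does not depend on \<open>p\<close>, the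
  bound is linear in the input length.\<close>

lemma conj_tm_outputs:
  "outputs_within M (encode_sum p) (encode_word (conj_product j E t p))
     (poly [:1, 3 * E:] (length (encode_sum p)))"
proof -
  let ?xs = "encode_sum p" and ?ys = "encode_word (conj_product j E t p)"
  have xs: "?xs = concat (map (\<lambda>u. u @ [Plus]) (map encode_word p))"
    by (simp add: encode_sum_def comp_def)
  have "runs M (3 * E * length ?xs) (io_config ?xs 0 0 []) (io_config ?xs 0 (int (length ?xs)) ?ys)"
    using process_sum[of "map encode_word p" "[]" ?xs "[]"] Plus_notin_encode_word
    by (auto simp: xs encode_conj_product)
  moreover have "step M (io_config ?xs 0 (int (length ?xs)) ?ys) =
      io_config ?xs (4 * E) (move_head Stay (int (length ?xs))) ?ys"
    by (rule step_silent[OF string_on_tape_end]) (use E in \<open>simp_all add: conj_tm_def conj_delta_def Let_def\<close>)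
  note runs_step[OF this]
  ultimately have "runs M (3 * E * length ?xs + 1)
      (io_config ?xs 0 0 []) (io_config ?xs (4 * E) (int (length ?xs)) ?ys)"
    unfolding move_head.simps by (rule runs_trans) simp
  moreover have "init_config M ?xs = io_config ?xs 0 0 []"
    by (simp add: init_config_def io_config_def conj_tm_def string_on_tape_def fun_eq_iff)
  ultimately obtain n where "n \<le> 3 * E * length ?xs + 1"
    and "(step M ^^ n) (init_config M ?xs) = io_config ?xs (4 * E) (int (length ?xs)) ?ys"
    unfolding runs_def by auto
  then show ?thesis
    unfolding outputs_within_def
    by (intro exI[of _ n]) (simp add: io_config_def conj_tm_def algebra_simps)
qed

end


subsection \<open>The affine group\<close>

lemma finite_carrier_vec: "finite (carrier_vec n :: 'a::finite vec set)"
proof (rule finite_subset)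
  show "(carrier_vec n :: 'a vec set) \<subseteq> vec_of_list ` {xs. set xs \<subseteq> UNIV \<and> length xs = n}"
  proof
    fix v :: "'a vec"
    assume "v \<in> carrier_vec n"
    then show "v \<in> vec_of_list ` {xs. set xs \<subseteq> UNIV \<and> length xs = n}"
      by (intro image_eqI[of _ _ "list_of_vec v"]) (auto simp: vec_list)
  qed
qed (intro finite_imageI finite_lists_length_eq finite)

lemma finite_carrier_mat: "finite (carrier_mat m n :: 'a::finite mat set)"
proof (rule finite_subset)
  show "(carrier_mat m n :: 'a mat set) \<subseteq> mat m n ` (PiE ({..<m} \<times> {..<n}) (\<lambda>_. UNIV))"
  proof
    fix A :: "'a mat"
    assume "A \<in> carrier_mat m n"
    then have "A = mat m n (restrict (\<lambda>ij. A $$ ij) ({..<m} \<times> {..<n}))"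
      by (intro eq_matI) auto
    then show "A \<in> mat m n ` (PiE ({..<m} \<times> {..<n}) (\<lambda>_. UNIV))"
      by (rule image_eqI[where f = "mat m n"]) (simp only: restrict_PiE_iff UNIV_I ball_simps Ball_def simp_thms)
  qed
qed (intro finite_imageI finite_PiE finite_cartesian_product finite_lessThan finite)

section \<open>The general linear group\<close>

lemma GL_carrier: "A \<in> GL m \<Longrightarrow> A \<in> carrier_mat m m"
  by (simp add: GL_def)

lemma finite_GL: "finite (GL m :: 'a::{field,finite} mat set)"
  by (rule finite_subset[OF _ finite_carrier_mat[of m m]]) (auto simp: GL_def)

lemma GL_I:
  assumes "A \<in> carrier_mat m m" and "B \<in> carrier_mat m m" and "A * B = 1\<^sub>m m" and "B * A = 1\<^sub>m m"
  shows "A \<in> GL m"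
  using assms by (auto simp: GL_def invertible_mat_def inverts_mat_def)

lemma GL_E:
  assumes "A \<in> GL m"
  obtains B where "B \<in> GL m" and "A * B = 1\<^sub>m m" and "B * A = 1\<^sub>m m"
proof -
  from assms obtain B where AB: "A * B = 1\<^sub>m m" and BA: "B * A = 1\<^sub>m (dim_row B)"
    by (auto simp: GL_def invertible_mat_def inverts_mat_def)
  have A: "A \<in> carrier_mat m m"
    using assms by (rule GL_carrier)
  \<comment> \<open>\<open>invertible_mat\<close> does not fix the dimensions of the inverse; they
    are recovered by comparing the column counts of both sides of each equation.\<close>
  have "dim_col B = m" "dim_row B = m"
    using arg_cong[OF AB, of dim_col] arg_cong[OF BA, of dim_col] A by auto
  then have "B \<in> carrier_mat m m" and BA': "B * A = 1\<^sub>m m"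
    using BA by auto
  with A AB that show thesis
    by (blast intro: GL_I)
qed

lemma one_GL: "1\<^sub>m m \<in> GL m"
  by (rule GL_I[of _ _ "1\<^sub>m m"]) auto

lemma mult_GL:
  assumes "A \<in> GL m" and "B \<in> GL m"
  shows "A * B \<in> GL m"
proof -
  obtain A' where A': "A' \<in> GL m" "A * A' = 1\<^sub>m m" "A' * A = 1\<^sub>m m"
    using assms(1) by (rule GL_E)
  obtain B' where B': "B' \<in> GL m" "B * B' = 1\<^sub>m m" "B' * B = 1\<^sub>m m"
    using assms(2) by (rule GL_E)
  note c = assms[THEN GL_carrier] A'(1)[THEN GL_carrier] B'(1)[THEN GL_carrier]
  have "A * B * (B' * A') = A * (B * B') * A'"
    using c by (simp add: assoc_mult_mat[of _ m m _ m _ m])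
  moreover have "B' * A' * (A * B) = B' * (A' * A) * B"
    using c by (simp add: assoc_mult_mat[of _ m m _ m _ m])
  ultimately show ?thesis
    using c A' B' by (intro GL_I[of _ _ "B' * A'"]) auto
qed

section \<open>The group structure of \<open>Hol m\<close> and its exponent\<close>

lemma Hol_simps [simp]:
  "carrier (Hol m) = carrier_vec m \<times> GL m"
  "(v, A) \<otimes>\<^bsub>Hol m\<^esub> (w, B) = (v + A *\<^sub>v w, A * B)"
  "\<one>\<^bsub>Hol m\<^esub> = (0\<^sub>v m, 1\<^sub>m m)"
  by (simp_all add: Hol_def)

lemma group_Hol: "group (Hol m :: ('a::field vec \<times> 'a mat) monoid)"
proof (rule groupI)
  fix x y z :: "'a vec \<times> 'a mat"
  assume *: "x \<in> carrier (Hol m)" "y \<in> carrier (Hol m)" "z \<in> carrier (Hol m)"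
  then obtain u A v B w C where xyz: "x = (u, A)" "y = (v, B)" "z = (w, C)"
    by (metis surj_pair)
  then have c: "u \<in> carrier_vec m" "v \<in> carrier_vec m" "w \<in> carrier_vec m"
      "A \<in> carrier_mat m m" "B \<in> carrier_mat m m" "C \<in> carrier_mat m m"
    using * by (auto intro: GL_carrier)
  have "A *\<^sub>v (v + B *\<^sub>v w) = A *\<^sub>v v + A * B *\<^sub>v w"
    using c by (simp add: mult_add_distrib_mat_vec[of _ m m])
  then show "x \<otimes>\<^bsub>Hol m\<^esub> y \<otimes>\<^bsub>Hol m\<^esub> z = x \<otimes>\<^bsub>Hol m\<^esub> (y \<otimes>\<^bsub>Hol m\<^esub> z)"
    using c by (simp add: xyz assoc_add_vec[of _ m])
next
  fix x :: "'a vec \<times> 'a mat"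
  assume "x \<in> carrier (Hol m)"
  then obtain u A where x: "x = (u, A)" "u \<in> carrier_vec m" "A \<in> GL m"
    by auto
  then obtain B where B: "B \<in> GL m" "B * A = 1\<^sub>m m"
    by (blast elim: GL_E)
  \<comment> \<open>Inverse of the affine map that sends \<open>x\<close> to \<open>A x + u\<close>;
    a left inverse is all that \<open>groupI\<close> asks for.\<close>
  have "(- (B *\<^sub>v u), B) \<otimes>\<^bsub>Hol m\<^esub> x = \<one>\<^bsub>Hol m\<^esub>"
    using x B GL_carrier[OF B(1)] by (simp add: uminus_l_inv_vec[of _ m])
  moreover have "(- (B *\<^sub>v u), B) \<in> carrier (Hol m)"
    using x B GL_carrier[OF B(1)] by simp
  ultimately show "\<exists>y\<in>carrier (Hol m). y \<otimes>\<^bsub>Hol m\<^esub> x = \<one>\<^bsub>Hol m\<^esub>"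
    by blast
next
  fix x y :: "'a vec \<times> 'a mat"
  assume "x \<in> carrier (Hol m)" and "y \<in> carrier (Hol m)"
  then show "x \<otimes>\<^bsub>Hol m\<^esub> y \<in> carrier (Hol m)"
    by (auto simp: mult_GL intro!: add_carrier_vec mult_mat_vec_carrier[OF GL_carrier])
qed (auto simp: one_GL dest: GL_carrier)

lemma Hol_exponent:
  obtains E where "2 \<le> E"
    and "\<And>g. g \<in> carrier (Hol m :: ('a::{field,finite} vec \<times> 'a mat) monoid) \<Longrightarrow>
           g [^]\<^bsub>Hol m\<^esub> (E :: nat) = \<one>\<^bsub>Hol m\<^esub>"
proof -
  let ?G = "Hol m :: ('a vec \<times> 'a mat) monoid"
  interpret group ?G
    by (rule group_Hol)
  have "finite (carrier ?G)"
    by (simp add: finite_carrier_vec finite_GL)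
  then have "0 < Coset.order ?G"
    by (simp add: order_gt_0_iff_finite)
  \<comment> \<open>Doubling the order gives an exponent of at least 2 even when the group is
    trivial, as for \<open>m = 0\<close>.\<close>
  moreover have "g [^]\<^bsub>?G\<^esub> (Coset.order ?G * 2) = \<one>\<^bsub>?G\<^esub>" if "g \<in> carrier ?G" for g
    by (simp only: nat_pow_pow[OF that, symmetric] pow_order_eq_1[OF that] nat_pow_one)
  ultimately show thesis
    by (intro that[of "Coset.order ?G * 2"]) auto
qed


subsection \<open>Evaluating the rewritten expression\<close>

lemma eval_word_simps [simp]:
  "eval_word G \<sigma> [] = \<one>\<^bsub>G\<^esub>"
  "eval_word G \<sigma> (l # w) = eval_letter \<sigma> l \<otimes>\<^bsub>G\<^esub> eval_word G \<sigma> w"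
  by (simp_all add: eval_word_def)

lemma eval_sum_simps [simp]:
  "eval_sum R \<sigma> [] = \<zero>\<^bsub>R\<^esub>"
  "eval_sum R \<sigma> (w # p) = eval_word R \<sigma> w \<oplus>\<^bsub>R\<^esub> eval_sum R \<sigma> p"
  by (simp_all add: eval_sum_def)

lemma consts_in_simps [simp]:
  "consts_in S []"
  "consts_in S (l # w) \<longleftrightarrow> (\<forall>g. l = Const g \<longrightarrow> g \<in> S) \<and> consts_in S w"
  "consts_in S (w @ w') \<longleftrightarrow> consts_in S w \<and> consts_in S w'"
  by (auto simp: consts_in_def)

lemma consts_in_concat: "consts_in S (concat ws) \<longleftrightarrow> (\<forall>w\<in>set ws. consts_in S w)"
  by (auto simp: consts_in_def)

context monoid
begin

lemma eval_letter_closed: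
  assumes "\<And>i. \<sigma> i \<in> carrier G" and "consts_in (carrier G) (l # w)"
  shows "eval_letter \<sigma> l \<in> carrier G"
  using assms by (cases l) auto

lemma eval_word_closed:
  assumes "\<And>i. \<sigma> i \<in> carrier G" and "consts_in (carrier G) w"
  shows "eval_word G \<sigma> w \<in> carrier G"
  using assms(2)
proof (induction w)
  case (Cons l w)
  then show ?case
    using eval_letter_closed[OF assms(1) Cons.prems] by simp
qed simp

lemma eval_word_append:
  assumes "\<And>i. \<sigma> i \<in> carrier G" and "consts_in (carrier G) w" and "consts_in (carrier G) w'"
  shows "eval_word G \<sigma> (w @ w') = eval_word G \<sigma> w \<otimes> eval_word G \<sigma> w'"
  using assms(2)
proof (induction w)
  case (Cons l w)
  then show ?case
    using eval_letter_closed[OF assms(1) Cons.prems] eval_word_closed[OF assms(1)] assms(3)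
    by (simp add: m_assoc)
qed (use eval_word_closed[OF assms(1,3)] in simp)

lemma eval_word_concat_replicate:
  assumes "\<And>i. \<sigma> i \<in> carrier G" and "consts_in (carrier G) w"
  shows "eval_word G \<sigma> (concat (replicate n w)) = eval_word G \<sigma> w [^] n"
proof (induction n)
  case (Suc n)
  have "consts_in (carrier G) (concat (replicate n w))"
    using assms(2) by (simp add: consts_in_concat)
  then show ?case
    using Suc eval_word_append[OF assms] eval_word_closed[OF assms] nat_pow_Suc2 by simp
qed simp

end

section \<open>Products of conjugates of translations\<close>

lemma Hol_conj_translation:
  fixes g :: "'a::field vec \<times> 'a mat"
  assumes g: "g \<in> carrier (Hol m)" and v: "v \<in> carrier_vec m"
    and E: "E > 0" "g [^]\<^bsub>Hol m\<^esub> (E :: nat) = \<one>\<^bsub>Hol m\<^esub>"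
  shows "g \<otimes>\<^bsub>Hol m\<^esub> ((v, 1\<^sub>m m) \<otimes>\<^bsub>Hol m\<^esub> g [^]\<^bsub>Hol m\<^esub> (E - 1)) = (snd g *\<^sub>v v, 1\<^sub>m m)"
proof -
  interpret group "Hol m :: ('a vec \<times> 'a mat) monoid"
    by (rule group_Hol)
  obtain a A where gA: "g = (a, A)" "a \<in> carrier_vec m" "A \<in> GL m"
    using g by auto
  note A = GL_carrier[OF gA(3)]
  have t: "(v, 1\<^sub>m m) \<in> carrier (Hol m)" "(A *\<^sub>v v, 1\<^sub>m m) \<in> carrier (Hol m)"
    using v A one_GL by auto
  \<comment> \<open>Both sides equal \<open>(a + A v, A)\<close>. Moving the translation to the left
    of \<open>g\<close> leaves \<open>g\<close> times its power \<open>E - 1\<close>, which is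
    1.\<close>
  have "g \<otimes>\<^bsub>Hol m\<^esub> (v, 1\<^sub>m m) = (A *\<^sub>v v, 1\<^sub>m m) \<otimes>\<^bsub>Hol m\<^esub> g"
    using gA A v by (simp add: comm_add_vec[of _ m])
  then have "g \<otimes>\<^bsub>Hol m\<^esub> ((v, 1\<^sub>m m) \<otimes>\<^bsub>Hol m\<^esub> g [^]\<^bsub>Hol m\<^esub> (E - 1)) =
      (A *\<^sub>v v, 1\<^sub>m m) \<otimes>\<^bsub>Hol m\<^esub> (g \<otimes>\<^bsub>Hol m\<^esub> g [^]\<^bsub>Hol m\<^esub> (E - 1))"
    using g t by (metis m_assoc nat_pow_closed)
  also have "g \<otimes>\<^bsub>Hol m\<^esub> g [^]\<^bsub>Hol m\<^esub> (E - 1) = \<one>\<^bsub>Hol m\<^esub>"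
    using nat_pow_Suc2[OF g, of "E - 1"] E by simp
  finally show ?thesis
    using t gA by (metis r_one snd_conv)
qed

text \<open>The embedding of the general linear group as the stabilizer of the zero vector; the
  dimension is read off the matrix.\<close>

abbreviation linear_elem :: "'a::field mat \<Rightarrow> 'a vec \<times> 'a mat" where
  "linear_elem A \<equiv> (0\<^sub>v (dim_row A), A)"

lemma consts_in_lift_word:
  assumes "consts_in (GL m) w"
  shows "consts_in (carrier (Hol m)) (lift_word linear_elem w)"
proof -
  have "consts_in (carrier (Hol m)) (map (lift_letter linear_elem) w)"
    using assms
  proof (induction w)
    case (Cons l w)
    then show ?case
      by (cases l) (auto dest: GL_carrier)
  qed simp
  then show ?thesis
    by (simp add: lift_word_def)
qed

lemma consts_in_conj_product:
  assumes "p \<in> restricted_expressions m" and "v \<in> carrier_vec m"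
  shows "consts_in (carrier (Hol m)) (conj_product linear_elem E (v, 1\<^sub>m m) p)"
  using assms consts_in_lift_word one_GL
  by (auto simp: conj_product_def conj_word_def consts_in_concat restricted_expressions_def)

text \<open>A conjugate of a translation depends only on the linear part of the conjugating element,
  so the vector parts of \<open>\<sigma>\<close> disappear. The odd variables supply
  \<open>\<tau>\<close> and the variable 0 supplies the factor in front of \<open>v\<close>.\<close>

lemma eval_conj_product:
  fixes \<sigma> :: "nat \<Rightarrow> 'a::field vec \<times> 'a mat"
  assumes \<sigma>: "\<And>i. \<sigma> i \<in> carrier (Hol m)" and p: "p \<in> restricted_expressions m"
    and v: "v \<in> carrier_vec m" and E: "E > 0"
    and exponent: "\<And>g. g \<in> carrier (Hol m :: ('a vec \<times> 'a mat) monoid) \<Longrightarrow>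
           g [^]\<^bsub>Hol m\<^esub> (E :: nat) = \<one>\<^bsub>Hol m\<^esub>"
  defines "\<tau> \<equiv> \<lambda>i. snd (\<sigma> (2 * i + 1))"
  shows "eval_sum (ring_mat TYPE('a) m ()) \<tau> p \<in> carrier_mat m m"
    and "eval_word (Hol m) \<sigma> (conj_product linear_elem E (v, 1\<^sub>m m) p) =
      (eval_sum (ring_mat TYPE('a) m ()) \<tau> p *\<^sub>v (snd (\<sigma> 0) *\<^sub>v v), 1\<^sub>m m)"
proof -
  let ?G = "Hol m :: ('a vec \<times> 'a mat) monoid" and ?R = "ring_mat TYPE('a) m ()"
  let ?Y = "snd (\<sigma> 0)"
  interpret group ?G
    by (rule group_Hol)
  have \<sigma>_GL: "snd (\<sigma> i) \<in> GL m" for i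
    using \<sigma>[of i] by (simp add: mem_Times_iff)
  then have Y: "?Y \<in> carrier_mat m m"
    by (rule GL_carrier)
  \<comment> \<open>Projection to the matrix part is multiplicative; the factor \<open>?Y\<close>
    comes from the \<open>Var 0\<close> that ends every lifted word.\<close>
  have word: "eval_word ?R \<tau> w \<in> carrier_mat m m \<and>
      snd (eval_word ?G \<sigma> (lift_word linear_elem w)) = eval_word ?R \<tau> w * ?Y"
    if "consts_in (GL m) w" for w
    using that
  proof (induction w)
    case Nil
    show ?case
      using Y by (cases "\<sigma> 0") (simp add: lift_word_def ring_mat_simps)
  next
    case (Cons l w)
    let ?l = "eval_letter \<sigma> (lift_letter linear_elem l)"
    have l: "snd ?l = eval_letter \<tau> l" "eval_letter \<tau> l \<in> carrier_mat m m"
      using Cons.prems \<sigma>_GL by (cases l; auto simp: \<tau>_def intro: GL_carrier)+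
    have snd_mult: "snd (x \<otimes>\<^bsub>?G\<^esub> y) = snd x * snd y" for x y
      by (cases x; cases y) simp
    have "snd (eval_word ?G \<sigma> (lift_word linear_elem (l # w))) =
        snd ?l * snd (eval_word ?G \<sigma> (lift_word linear_elem w))"
      by (simp add: lift_word_def snd_mult)
    with Cons l Y show ?case
      by (simp add: ring_mat_simps assoc_mult_mat[of _ m m _ m _ m])
  qed
  have "eval_sum ?R \<tau> p \<in> carrier_mat m m \<and>
    eval_word ?G \<sigma> (conj_product linear_elem E (v, 1\<^sub>m m) p) =
      (eval_sum ?R \<tau> p *\<^sub>v (?Y *\<^sub>v v), 1\<^sub>m m)"
    using p
  proof (induction p)
    case Nil
    show ?case
      using mult_mat_vec_carrier[OF Y v] by (auto simp: conj_product_def ring_mat_simps)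
  next
    case (Cons w p)
    let ?u = "lift_word linear_elem w" and ?t = "(v, 1\<^sub>m m)"
    have w: "consts_in (GL m) w" and p: "p \<in> restricted_expressions m"
      using Cons.prems by (auto simp: restricted_expressions_def)
    note u = consts_in_lift_word[OF w]
    note g = eval_word_closed[OF \<sigma> u]
    have us: "consts_in (carrier ?G) (concat (replicate (E - 1) ?u))"
      using u by (simp add: consts_in_concat)
    have t: "?t \<in> carrier ?G"
      using v one_GL by simp
    have conj: "consts_in (carrier ?G) (conj_word E ?t ?u)"
      using u us t by (simp add: conj_word_def)
    have "eval_word ?G \<sigma> (conj_word E ?t ?u) =
        eval_word ?G \<sigma> ?u \<otimes>\<^bsub>?G\<^esub> (?t \<otimes>\<^bsub>?G\<^esub> eval_word ?G \<sigma> ?u [^]\<^bsub>?G\<^esub> (E - 1))"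
      using u us t
      by (simp add: conj_word_def eval_word_append[OF \<sigma>] eval_word_concat_replicate[OF \<sigma>]
          del: Hol_simps)
    also have "\<dots> = (eval_word ?R \<tau> w * ?Y *\<^sub>v v, 1\<^sub>m m)"
      using Hol_conj_translation[OF g v E exponent[OF g]] word[OF w] by simp
    finally have w_eval: "eval_word ?G \<sigma> (conj_word E ?t ?u) =
        (eval_word ?R \<tau> w *\<^sub>v (?Y *\<^sub>v v), 1\<^sub>m m)"
      using assoc_mult_mat_vec[OF conjunct1[OF word[OF w]] Y v] by simp
    have "eval_word ?G \<sigma> (conj_product linear_elem E ?t (w # p)) =
        eval_word ?G \<sigma> (conj_word E ?t ?u) \<otimes>\<^bsub>?G\<^esub>
        eval_word ?G \<sigma> (conj_product linear_elem E ?t p)"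
      using eval_word_append[OF \<sigma> conj consts_in_conj_product[OF p v]]
      by (simp add: conj_product_def)
    moreover have Yv: "?Y *\<^sub>v v \<in> carrier_vec m"
      using Y v by (rule mult_mat_vec_carrier)
    \<comment> \<open>The first factor is a translation, whose linear part 1 leaves the second
      vector unchanged; hence the vectors of the conjugates simply add up.\<close>
    moreover have "1\<^sub>m m *\<^sub>v (eval_sum ?R \<tau> p *\<^sub>v (?Y *\<^sub>v v)) = eval_sum ?R \<tau> p *\<^sub>v (?Y *\<^sub>v v)"
      using Cons.IH[OF p] Yv by (intro one_mult_mat_vec) (auto intro: mult_mat_vec_carrier)
    ultimately show ?case
      using w_eval Cons.IH[OF p] word[OF w]
      by (simp add: ring_mat_simps add_mult_distrib_mat_vec[of _ m m])
  qed
  then show "eval_sum ?R \<tau> p \<in> carrier_mat m m"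
    and "eval_word ?G \<sigma> (conj_product linear_elem E (v, 1\<^sub>m m) p) =
      (eval_sum ?R \<tau> p *\<^sub>v (?Y *\<^sub>v v), 1\<^sub>m m)"
    by auto
qed

section \<open>Recognizing the zero matrix by its columns\<close>

lemma mult_mat_unit_vec:
  assumes "A \<in> carrier_mat m n" and "k < n"
  shows "A *\<^sub>v unit_vec n k = (col A k :: 'a::semiring_1 vec)"
  using assms by (intro eq_vecI) auto

text \<open>Permutation matrices already move the first unit vector to every other one, and
  \<open>A\<close> applied to the unit vector \<open>k\<close> is its column
  \<open>k\<close>.\<close>

lemma zero_mat_iff_GL_unit_vec:
  fixes A :: "'a::field mat"
  assumes A: "A \<in> carrier_mat m m"
  shows "A = 0\<^sub>m m m \<longleftrightarrow> (\<forall>Y\<in>GL m. A *\<^sub>v (Y *\<^sub>v unit_vec m 0) = 0\<^sub>v m)"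
proof
  assume "A = 0\<^sub>m m m"
  then show "\<forall>Y\<in>GL m. A *\<^sub>v (Y *\<^sub>v unit_vec m 0) = 0\<^sub>v m"
    by (auto dest!: GL_carrier)
next
  assume *: "\<forall>Y\<in>GL m. A *\<^sub>v (Y *\<^sub>v unit_vec m 0) = 0\<^sub>v m"
  show "A = 0\<^sub>m m m"
  proof (rule eq_matI)
    fix i k
    assume "i < dim_row (0\<^sub>m m m :: 'a mat)" and "k < dim_col (0\<^sub>m m m :: 'a mat)"
    then have i: "i < m" and k: "k < m"
      by auto
    \<comment> \<open>The transposition of coordinates 0 and \<open>k\<close>, which is its own
      inverse; \<open>k < m\<close> makes 0 a valid index too.\<close>
    let ?Y = "swaprows_mat m 0 k :: 'a mat"
    have "?Y \<in> GL m"
      using k swaprows_mat_inv[of 0 m k] by (intro GL_I[of _ _ ?Y]) auto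
    moreover have "?Y *\<^sub>v unit_vec m 0 = unit_vec m k"
      using k by (intro eq_vecI) (auto simp: mult_mat_unit_vec[of _ m m])
    ultimately have "A *\<^sub>v unit_vec m k = 0\<^sub>v m"
      using * by metis
    then have "col A k = 0\<^sub>v m"
      using A k by (simp add: mult_mat_unit_vec)
    then show "A $$ (i, k) = 0\<^sub>m m m $$ (i, k)"
      using A i k by (metis carrier_matD index_col index_zero_mat(1) index_zero_vec(1))
  qed (use A in auto)
qed

section \<open>Running time and correctness of the reduction\<close>

theorem theorem4p2:
  fixes m q :: nat
  assumes "primepow q"
    and "CARD('a::{field,finite}) = q"
    and "(m, q) \<noteq> (1, 2)"
  shows "polytime_reducible
           (RestrictedPolEqv m :: ('a mat letter list list, 'a mat symbol) problem)
           (PolEqv (Hol m :: ('a vec \<times> 'a mat) monoid))"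
proof -
  let ?G = "Hol m :: ('a vec \<times> 'a mat) monoid" and ?R = "ring_mat TYPE('a) m ()"
  let ?A = "RestrictedPolEqv m :: ('a mat letter list list, 'a mat symbol) problem"
  let ?v = "unit_vec m 0 :: 'a vec"
  obtain E :: nat where E: "2 \<le> E"
    and exponent: "\<And>g. g \<in> carrier ?G \<Longrightarrow> g [^]\<^bsub>?G\<^esub> E = \<one>\<^bsub>?G\<^esub>"
    using Hol_exponent[where 'a = 'a and m = m] by blast
  let ?P = "conj_product linear_elem E (?v, 1\<^sub>m m)"
  let ?M = "conj_tm (GL m) linear_elem E (?v, 1\<^sub>m m)"
  have in_carrier: "consts_in (carrier ?G) (?P p)" if "p \<in> restricted_expressions m" for p
    using consts_in_conj_product[OF that] by simp
  have in_alphabet: "Input ` set (encode_sum p) \<subseteq> alphabet ?M" if "p \<in> restricted_expressions m" for p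
  proof -
    have "set (encode_word w) \<subseteq> ConstSym ` GL m \<union> {VarSym, Bit True, Bit False}" if "w \<in> set p" for w
      using \<open>p \<in> _\<close> that by (intro set_encode_word) (simp add: restricted_expressions_def)
    then have "set (encode_sum p) \<subseteq> ConstSym ` GL m \<union> {VarSym, Bit True, Bit False, Plus}"
      by (auto simp: encode_sum_def dest: subsetD)
    then show ?thesis
      by (auto simp: conj_tm_def)
  qed
  have "wf_tm ?M"
    using finite_GL E by (intro wf_conj_tm) auto
  then have transformation: "polytime_transformation ?A (PolEqv ?G) ?P"
    unfolding polytime_transformation_def
    using in_carrier in_alphabet conj_tm_outputs[OF E]
    by (intro conjI exI[of _ ?M] exI[of _ "[:1, 3 * E:]"]) (auto simp: RestrictedPolEqv_def PolEqv_def)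
  have "p \<in> yes ?A \<longleftrightarrow> ?P p \<in> yes (PolEqv ?G)" if p: "p \<in> restricted_expressions m" for p
  proof -
    note eval = eval_conj_product[OF _ p unit_vec_carrier[of m 0] _ exponent]
    have "(\<forall>\<tau>. (\<forall>i. \<tau> i \<in> GL m) \<longrightarrow> eval_sum ?R \<tau> p = 0\<^sub>m m m) \<longleftrightarrow>
      (\<forall>\<sigma>. (\<forall>i. \<sigma> i \<in> carrier ?G) \<longrightarrow> eval_word ?G \<sigma> (?P p) = \<one>\<^bsub>?G\<^esub>)" (is "?L \<longleftrightarrow> ?R'")
    proof
      assume L: ?L
      show ?R'
      proof (intro allI impI)
        fix \<sigma> :: "nat \<Rightarrow> 'a vec \<times> 'a mat"
        assume \<sigma>: "\<forall>i. \<sigma> i \<in> carrier ?G"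
        then have GL: "snd (\<sigma> i) \<in> GL m" for i
          by (simp add: mem_Times_iff)
        \<comment> \<open>The matrix parts of the odd variables form an admissible assignment for
          \<open>p\<close>, so the translation vector is 0.\<close>
        then have "eval_sum ?R (\<lambda>i. snd (\<sigma> (2 * i + 1))) p = 0\<^sub>m m m"
          by (intro L[rule_format])
        then show "eval_word ?G \<sigma> (?P p) = \<one>\<^bsub>?G\<^esub>"
          using eval(2)[of \<sigma>] \<sigma> E mult_mat_vec_carrier[OF GL_carrier[OF GL[of 0]]]
          by (auto simp: mult_mat_vec_carrier)
      qed
    next
      assume R: ?R'
      show ?L
      proof (intro allI impI)
        fix \<tau> :: "nat \<Rightarrow> 'a mat"
        assume \<tau>: "\<forall>i. \<tau> i \<in> GL m"
        have "eval_sum ?R \<tau> p \<in> carrier_mat m m \<and>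
            eval_sum ?R \<tau> p *\<^sub>v (Y *\<^sub>v ?v) = 0\<^sub>v m" if Y: "Y \<in> GL m" for Y
        proof -
          \<comment> \<open>Since \<open>(2 * i + 1) div 2 = i\<close>, the variable
            \<open>2 * i + 1\<close> receives \<open>\<tau> i\<close> and the fresh variable 0
            receives \<open>Y\<close>. Other even indices do not occur in the rewritten
            word.\<close>
          define \<sigma> where "\<sigma> i = (0\<^sub>v m :: 'a vec, if i = 0 then Y else \<tau> (i div 2))" for i :: nat
          have \<sigma>: "\<sigma> i \<in> carrier ?G" for i
            using Y \<tau> by (simp add: \<sigma>_def)
          have \<tau>_eq: "(\<lambda>i. snd (\<sigma> (2 * i + 1))) = \<tau>" and Y_eq: "snd (\<sigma> 0) = Y"
            by (simp_all add: \<sigma>_def)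
          have "0 < E"
            using E by simp
          from eval[of \<sigma>, OF \<sigma> this, unfolded \<tau>_eq Y_eq] R \<sigma> show ?thesis
            by simp
        qed
        \<comment> \<open>The identity serves as an instance of \<open>Y\<close> from which the
          dimensions of the sum are obtained.\<close>
        then show "eval_sum ?R \<tau> p = 0\<^sub>m m m"
          using zero_mat_iff_GL_unit_vec one_GL by blast
      qed
    qed
    then show ?thesis
      using p in_carrier[OF p] by (simp add: RestrictedPolEqv_def PolEqv_def ring_mat_simps)
  qed
  with transformation show ?thesis
    unfolding polytime_reducible_def by (auto simp: RestrictedPolEqv_def)
qed

end
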